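(* Let $a<b$ be real numbers and let $f:[a,b]\to\mathbb{R}$ be convex on $[a,b]$. Then for all integers $m\ge2$ and $n\ge1$, $$\frac{1}{m-1}\sum_{i=1}^{m-1}f\left(x_i^{(m)}\right)\le\frac{1}{b-a}\int_a^b f(t)\,dt\le\frac{1}{n+1}\sum_{i=0}^{n}f\left(x_i^{(n)}\right).$$ Both inequalities are strict if $f$ is strictly convex.
   Context: For an integer $k\ge1$ and $i=0,1,\ldots,k$, $x_i^{(k)}=a+i\frac{b-a}{k}$. *)

theory Defs
  imports "HOL-Analysis.Analysis"
begin

definition grid_point :: "real \<Rightarrow> real \<Rightarrow> nat \<Rightarrow> nat \<Rightarrow> real" where
  "grid_point a b k i = a + real i * ((b - a) / real k)"

text \<open>The strict counterpart of \<^const>\<open>convex_on\<close>, which the library lacks; like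
  \<^const>\<open>convex_on\<close>, it includes convexity of the domain.\<close>

definition strictly_convex_on :: "'a::real_vector set \<Rightarrow> ('a \<Rightarrow> real) \<Rightarrow> bool" where
  "strictly_convex_on S f \<longleftrightarrow> convex S \<and>
    (\<forall>x\<in>S. \<forall>y\<in>S. x \<noteq> y \<longrightarrow>
      (\<forall>u>0. \<forall>v>0. u + v = 1 \<longrightarrow>
        f (u *\<^sub>R x + v *\<^sub>R y) < u * f x + v * f y))"

end

theory Submission
  imports Defs
begin

text \<open>By the Hermite--Hadamard inequality on each of the \<open>n\<close> equal parts of \<open>[a, b]\<close>, the mean of
  \<open>f\<close> is at most the trapezoidal mean, which is at most the mean over all \<open>n + 1\<close> nodes because the
  latter is at most \<open>(f a + f b) / 2\<close>. For the lower bound, use \<open>m - 1\<close> equal parts: the mean of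
  \<open>f\<close> is at least the mean over the \<open>m - 1\<close> midpoints \<open>y\<^sub>i\<close>. The interior nodes \<open>x\<^sub>i\<close> of the
  subdivision into \<open>m\<close> parts are a contraction of the \<open>y\<^sub>i\<close> about the centre, namely
  \<open>x\<^sub>i = (1 - v) y\<^sub>i + v y\<^sub>m\<^sub>-\<^sub>i\<close> with \<open>v = 1 / (2 m)\<close>, so convexity gives \<open>\<Sum> f x\<^sub>i \<le> \<Sum> f y\<^sub>i\<close>.\<close>

section \<open>Convex functions on an interval: symmetric pairs and integrability\<close>

text \<open>The two convexity bounds carry swapped weights, so the weights cancel on adding.\<close>

lemma convex_on_pair_le:
  fixes f :: "real \<Rightarrow> real"
  assumes "convex_on S f" "p \<in> S" "q \<in> S" "0 \<le> u" "u \<le> 1"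
  shows "f ((1 - u) * p + u * q) + f (u * p + (1 - u) * q) \<le> f p + f q"
proof -
  have "f ((1 - u) * p + u * q) \<le> (1 - u) * f p + u * f q"
    using convex_onD[OF assms(1), of u p q] assms by simp
  moreover have "f (u * p + (1 - u) * q) \<le> u * f p + (1 - u) * f q"
    using convex_onD[OF assms(1), of "1 - u" p q] assms by simp
  ultimately show ?thesis by (simp add: algebra_simps)
qed

lemma convex_on_midpoint_le:
  fixes f :: "real \<Rightarrow> real"
  assumes "convex_on S f" "x \<in> S" "y \<in> S"
  shows "2 * f ((x + y) / 2) \<le> f x + f y"
  using convex_on_pair_le[OF assms, of "1/2"] by (simp add: field_simps)

text \<open>Reflection about the centre swaps the weights that express \<open>x\<close> through the
  endpoints.\<close>

lemma convex_on_Icc_reflect_le: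
  fixes f :: "real \<Rightarrow> real"
  assumes "convex_on {c..d} f" "x \<in> {c..d}"
  shows "f x + f (c + d - x) \<le> f c + f d"
proof (cases "c < d")
  case True
  define u where "u = (x - c) / (d - c)"
  have u: "0 \<le> u" "u \<le> 1" and x: "x = c + u * (d - c)"
    using assms True by (auto simp: u_def field_simps)
  have eqs: "(1 - u) * c + u * d = x" "u * c + (1 - u) * d = c + d - x"
    by (simp_all add: x algebra_simps)
  have "c \<in> {c..d}" "d \<in> {c..d}" using True by auto
  from convex_on_pair_le[OF assms(1) this u] show ?thesis
    unfolding eqs .
next
  case False
  with assms(2) have "x = c" "d = c" by auto
  then show ?thesis by simp
qed

text \<open>Convexity gives continuity only in the interior, since \<open>f\<close> may jump at the
  endpoints. So \<open>f\<close> is shown measurable and bounded on the open interval; the endpoints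
  do not affect integrability.\<close>

lemma convex_on_Icc_integrable:
  fixes f :: "real \<Rightarrow> real"
  assumes f: "convex_on {c..d} f"
  shows "f integrable_on {c..d}"
proof -
  \<comment> \<open>Convexity bounds \<open>f\<close> above by its endpoint values. The last term of
    \<open>B\<close> serves the lower bound
    \<open>f x \<ge> 2 * f ((c + d) / 2) - f (c + d - x)\<close>.\<close>
  define B where "B = \<bar>f c\<bar> + \<bar>f d\<bar> + 2 * \<bar>f ((c + d) / 2)\<bar>"
  have "f integrable_on {c<..<d}"
  proof (rule measurable_bounded_by_integrable_imp_integrable)
    have "convex_on {c<..<d} f"
      by (rule convex_on_subset[OF f]) auto
    then have "continuous_on {c<..<d} f"
      by (intro convex_on_continuous) auto
    then show "f \<in> borel_measurable (lebesgue_on {c<..<d})"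
      by (rule continuous_imp_measurable_on_sets_lebesgue) auto
    show "(\<lambda>x. B) integrable_on {c<..<d}"
      using integrable_on_open_interval[of "\<lambda>x. B" c d] integrable_const[of B c d] by simp
    have upper: "f x \<le> \<bar>f c\<bar> + \<bar>f d\<bar>" if "x \<in> {c..d}" for x
    proof -
      have "f x \<le> max (f c) (f d)"
        using that by (intro convex_on_le_max[OF f]) auto
      then show ?thesis by linarith
    qed
    show "norm (f x) \<le> B" if "x \<in> {c<..<d}" for x
    proof -
      have "f x \<le> \<bar>f c\<bar> + \<bar>f d\<bar>" "f (c + d - x) \<le> \<bar>f c\<bar> + \<bar>f d\<bar>"
        using that by (auto intro!: upper)
      moreover have "2 * f ((c + d) / 2) \<le> f x + f (c + d - x)"
        using convex_on_midpoint_le[OF f, of x "c + d - x"] that by simp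
      ultimately show ?thesis
        unfolding B_def real_norm_def by linarith
    qed
  qed auto
  then show ?thesis
    using integrable_on_open_interval[of f c d] by simp
qed

section \<open>The Hermite--Hadamard inequality, weak and strict\<close>

lemma has_integral_reflect_Icc:
  fixes f :: "real \<Rightarrow> real"
  assumes "(f has_integral I) {c..d}"
  shows "((\<lambda>x. f (c + d - x)) has_integral I) {c..d}"
proof -
  have "(\<lambda>x. - x + (c + d)) ` {c..d} = {c..d}"
    by (auto intro!: image_eqI[where x = "c + d - x" for x])
  with has_integral_affinity[of f I c d "-1" "c + d"] assms show ?thesis
    by (simp add: algebra_simps)
qed

text \<open>Adding the reflected function doubles the integral, and the sum lies pointwise between
  two constants: twice the midpoint value and \<open>f c + f d\<close>.\<close>

lemma hermite_hadamard:
  fixes f :: "real \<Rightarrow> real"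
  assumes f: "convex_on {c..d} f" and "c \<le> d"
  shows "(d - c) * f ((c + d) / 2) \<le> integral {c..d} f"
    and "integral {c..d} f \<le> (d - c) * ((f c + f d) / 2)"
proof -
  have "(f has_integral integral {c..d} f) {c..d}"
    using convex_on_Icc_integrable[OF f] by (simp add: integrable_integral)
  from has_integral_add[OF this has_integral_reflect_Icc[OF this]]
  have I: "((\<lambda>x. f x + f (c + d - x)) has_integral 2 * integral {c..d} f) {c..d}"
    by simp
  have const: "((\<lambda>x. C) has_integral (d - c) * C) {c..d}" for C :: real
    using has_integral_const_real[of C c d] \<open>c \<le> d\<close> by simp
  have "(d - c) * (2 * f ((c + d) / 2)) \<le> 2 * integral {c..d} f"
  proof (rule has_integral_le[OF const I])
    show "2 * f ((c + d) / 2) \<le> f x + f (c + d - x)" if "x \<in> {c..d}" for x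
      using convex_on_midpoint_le[OF f, of x "c + d - x"] that by simp
  qed
  then show "(d - c) * f ((c + d) / 2) \<le> integral {c..d} f" by simp
  have "2 * integral {c..d} f \<le> (d - c) * (f c + f d)"
    using convex_on_Icc_reflect_le[OF f] by (rule has_integral_le[OF I const])
  then show "integral {c..d} f \<le> (d - c) * ((f c + f d) / 2)" by simp
qed

lemma strictly_convex_on_subset:
  assumes "strictly_convex_on T f" "S \<subseteq> T" "convex S"
  shows "strictly_convex_on S f"
  using assms unfolding strictly_convex_on_def by blast

lemma strictly_convex_on_imp_convex_on:
  fixes f :: "'a::real_vector \<Rightarrow> real"
  assumes "strictly_convex_on S f"
  shows "convex_on S f"
proof (rule convex_onI)
  show "convex S" using assms by (simp add: strictly_convex_on_def)
  fix t :: real and x y assume "0 < t" "t < 1" "x \<in> S" "y \<in> S"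
  \<comment> \<open>Strict convexity says nothing when \<open>x = y\<close>; there the convexity
    bound is an equality.\<close>
  moreover have "f ((1 - t) *\<^sub>R x + t *\<^sub>R x) = (1 - t) * f x + t * f x"
    by (simp add: algebra_simps flip: scaleR_add_left)
  ultimately show "f ((1 - t) *\<^sub>R x + t *\<^sub>R y) \<le> (1 - t) * f x + t * f y"
    using assms unfolding strictly_convex_on_def
    by (cases "x = y") (auto intro!: less_imp_le)
qed

lemma strictly_convex_on_midpoint_less:
  fixes f :: "real \<Rightarrow> real"
  assumes "strictly_convex_on S f" "x \<in> S" "y \<in> S" "x \<noteq> y"
  shows "2 * f ((x + y) / 2) < f x + f y"
proof -
  have "f ((1/2) *\<^sub>R x + (1/2) *\<^sub>R y) < (1/2) * f x + (1/2) * f y"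
    using assms unfolding strictly_convex_on_def by (meson field_sum_of_halves half_gt_zero zero_less_one)
  then show ?thesis by (simp add: add_divide_distrib)
qed

text \<open>Bisecting the interval and using the weak inequality on both halves reduces strictness to a
  strict inequality between finitely many values of \<open>f\<close>.\<close>

lemma hermite_hadamard_strict:
  fixes f :: "real \<Rightarrow> real"
  assumes f: "strictly_convex_on {c..d} f" and "c < d"
  shows "(d - c) * f ((c + d) / 2) < integral {c..d} f"
    and "integral {c..d} f < (d - c) * ((f c + f d) / 2)"
proof -
  define e where "e = (c + d) / 2"
  have e: "c < e" "e < d" and half: "e - c = (d - c) / 2" "d - e = (d - c) / 2"
    using \<open>c < d\<close> by (auto simp: e_def field_simps)
  have cf: "convex_on {c..d} f" by (rule strictly_convex_on_imp_convex_on[OF f])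
  have f1: "convex_on {c..e} f" and f2: "convex_on {e..d} f"
    using e by (auto intro: convex_on_subset[OF cf])
  have split: "integral {c..d} f = integral {c..e} f + integral {e..d} f"
    using e convex_on_Icc_integrable[OF cf] by (simp add: Henstock_Kurzweil_Integration.integral_combine)
  \<comment> \<open>The weak midpoint bounds on the halves sample \<open>f\<close> at the quarter
    points, whose own midpoint is \<open>e\<close>.\<close>
  have "2 * f (((c + e) / 2 + (e + d) / 2) / 2) < f ((c + e) / 2) + f ((e + d) / 2)"
    using e by (intro strictly_convex_on_midpoint_less[OF f]) auto
  moreover have "((c + e) / 2 + (e + d) / 2) / 2 = e"
    by (simp add: e_def field_simps)
  ultimately have "(d - c) / 2 * (2 * f e) < (d - c) / 2 * (f ((c + e) / 2) + f ((e + d) / 2))"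
    using \<open>c < d\<close> by (intro mult_strict_left_mono) auto
  also have "\<dots> \<le> integral {c..d} f"
    using hermite_hadamard(1)[OF f1] hermite_hadamard(1)[OF f2] e
    unfolding split half distrib_left by linarith
  finally show "(d - c) * f ((c + d) / 2) < integral {c..d} f"
    by (simp add: e_def)
  have "integral {c..d} f \<le> (d - c) / 2 * (f e + (f c + f d) / 2)"
    using hermite_hadamard(2)[OF f1] hermite_hadamard(2)[OF f2] e
    by (simp add: split half field_simps)
  also have "\<dots> < (d - c) / 2 * (f c + f d)"
  proof (rule mult_strict_left_mono)
    have "2 * f e < f c + f d"
      using strictly_convex_on_midpoint_less[OF f, of c d] \<open>c < d\<close> by (simp add: e_def)
    then show "f e + (f c + f d) / 2 < f c + f d" by argo
  qed (use \<open>c < d\<close> in simp)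
  finally show "integral {c..d} f < (d - c) * ((f c + f d) / 2)"
    by simp
qed

section \<open>Grid points and splitting the integral into cells\<close>

lemma grid_point_0 [simp]: "grid_point a b k 0 = a"
  by (simp add: grid_point_def)

lemma grid_point_self [simp]: "k > 0 \<Longrightarrow> grid_point a b k k = b"
  by (simp add: grid_point_def)

lemma grid_point_Suc_diff: "grid_point a b k (Suc i) - grid_point a b k i = (b - a) / real k"
  by (simp add: grid_point_def algebra_simps flip: add_divide_distrib)

lemma grid_point_mono: "a \<le> b \<Longrightarrow> i \<le> j \<Longrightarrow> grid_point a b k i \<le> grid_point a b k j"
  by (simp add: grid_point_def mult_right_mono divide_right_mono)

lemma grid_point_in_Icc:
  assumes "a \<le> b" "k > 0" "i \<le> k"
  shows "grid_point a b k i \<in> {a..b}"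
  using grid_point_mono[OF assms(1), of 0 i k] grid_point_mono[OF assms(1,3), of k] assms(2) by simp

lemma grid_cell_subset:
  assumes "a \<le> b" "i < k"
  shows "{grid_point a b k i..grid_point a b k (Suc i)} \<subseteq> {a..b}"
  using grid_point_in_Icc[of a b k i] grid_point_in_Icc[of a b k "Suc i"] assms by auto

lemma integral_eq_sum_grid:
  fixes f :: "real \<Rightarrow> real"
  assumes "f integrable_on {a..b}" "a \<le> b" "k > 0"
  shows "integral {a..b} f
    = (\<Sum>i<k. integral {grid_point a b k i..grid_point a b k (Suc i)} f)"
proof -
  \<comment> \<open>Generalised to the first \<open>j\<close> cells for the induction.\<close>
  have "integral {a..grid_point a b k j} f
      = (\<Sum>i<j. integral {grid_point a b k i..grid_point a b k (Suc i)} f)" if "j \<le> k" for j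
    using that
  proof (induction j)
    case (Suc j)
    have "f integrable_on {a..grid_point a b k (Suc j)}"
      using grid_point_in_Icc[of a b k "Suc j"] Suc.prems assms
      by (auto intro: integrable_on_subinterval[OF assms(1)])
    then have "integral {a..grid_point a b k (Suc j)} f = integral {a..grid_point a b k j} f
        + integral {grid_point a b k j..grid_point a b k (Suc j)} f"
      using grid_point_in_Icc[of a b k j] grid_point_mono[of a b j "Suc j" k] Suc.prems assms
      by (simp add: Henstock_Kurzweil_Integration.integral_combine)
    with Suc show ?case by simp
  qed simp
  from this[of k] assms show ?thesis by simp
qed

section \<open>Comparison of node, midpoint and trapezoid sums\<close>

text \<open>Adjacent pairs share every term except the first and the last.\<close>

lemma sum_adjacent:
  fixes g :: "nat \<Rightarrow> real"
  shows "(\<Sum>i<n. g i + g (Suc i)) = 2 * (\<Sum>i=0..n. g i) - g 0 - g n"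
  by (induction n) auto

lemma interior_grid_sum_le_midpoint_sum:
  fixes f :: "real \<Rightarrow> real"
  assumes f: "convex_on {a..b} f" and "a \<le> b" and m: "m \<ge> 2"
  shows "(\<Sum>i = 1..m - 1. f (grid_point a b m i))
    \<le> (\<Sum>i<m - 1. f ((grid_point a b (m - 1) i + grid_point a b (m - 1) (Suc i)) / 2))"
proof -
  define k where "k = m - 1"
  have k: "m = Suc k" "k > 0" using m by (auto simp: k_def)
  define y where "y i = (grid_point a b k i + grid_point a b k (Suc i)) / 2" for i
  define v where "v = 1 / (2 * real m)"
  have v: "0 \<le> v" "v \<le> 1" using m by (auto simp: v_def field_simps)
  have y_in: "y i \<in> {a..b}" if "i < k" for i
    using grid_point_in_Icc[of a b k i] grid_point_in_Icc[of a b k "Suc i"] that \<open>a \<le> b\<close>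
    by (auto simp: y_def)
  \<comment> \<open>Cells are counted from 0, so the mirror image of \<open>y i\<close> is
    \<open>y (k - Suc i)\<close>.\<close>
  have le: "f (grid_point a b m (Suc i)) \<le> (1 - v) * f (y i) + v * f (y (k - Suc i))"
    if "i < k" for i
  proof -
    \<comment> \<open>A common unit: the two grid spacings are \<open>m\<close> and \<open>k\<close>
      times \<open>L\<close>.\<close>
    define L where "L = (b - a) / (real k * real m)"
    have L: "(b - a) / real k = real m * L" "(b - a) / real m = real k * L"
      using k by (simp_all add: L_def)
    have j: "real (k - Suc i) = real k - 1 - real i"
      using that by (simp add: of_nat_diff)
    have y_i: "y i = a + (real i + 1 / 2) * (real m * L)"
      by (simp add: y_def grid_point_def L algebra_simps add_divide_distrib)
    have y_j: "y (k - Suc i) = a + (real k - real i - 1 / 2) * (real m * L)"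
      by (simp add: y_def grid_point_def L j field_simps)
    have vm: "v * (real m * L) = L / 2"
      using m by (simp add: v_def)
    \<comment> \<open>Moving by the fraction \<open>v\<close> shifts \<open>y i\<close> by
      \<open>(k - 2 * i - 1) * L / 2\<close>; with \<open>m = k + 1\<close> this lands exactly on a
      multiple of \<open>k * L\<close>.\<close>
    have "(1 - v) * y i + v * y (k - Suc i)
        = a + (real i + 1 / 2) * (real m * L) + (real k - 2 * real i - 1) * (v * (real m * L))"
      unfolding y_i y_j by algebra
    also have "\<dots> = a + real (Suc i) * (real k * L)"
      unfolding vm by (simp add: k field_simps)
    finally have "grid_point a b m (Suc i) = (1 - v) * y i + v * y (k - Suc i)"
      by (simp add: grid_point_def L)
    with convex_onD[OF f v y_in y_in, of i "k - Suc i"] that show ?thesis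
      by simp
  qed
  have "(\<Sum>i = 1..m - 1. f (grid_point a b m i)) = (\<Sum>i<k. f (grid_point a b m (Suc i)))"
    by (simp add: k sum.atLeast1_atMost_eq)
  also have "\<dots> \<le> (\<Sum>i<k. (1 - v) * f (y i) + v * f (y (k - Suc i)))"
    by (intro sum_mono le) auto
  also have "\<dots> = (1 - v) * (\<Sum>i<k. f (y i)) + v * (\<Sum>i<k. f (y (k - Suc i)))"
    by (simp add: sum.distrib sum_distrib_left)
  \<comment> \<open>Reversing the second sum makes both sums equal, and the weights add up to
    1.\<close>
  also have "\<dots> = (\<Sum>i<k. f (y i))"
    using sum.nat_diff_reindex[of "\<lambda>i. f (y i)" k] by (simp add: algebra_simps)
  finally show ?thesis by (simp add: y_def k_def)
qed

text \<open>Adding the sum to its reversal pairs each node with its mirror image, and each pair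
  contributes at most \<open>f a + f b\<close>.\<close>

lemma grid_sum_le_endpoints:
  fixes f :: "real \<Rightarrow> real"
  assumes f: "convex_on {a..b} f" and "a \<le> b" and n: "n \<ge> 1"
  shows "(\<Sum>i = 0..n. f (grid_point a b n i)) \<le> (real n + 1) * ((f a + f b) / 2)"
proof -
  have "2 * (\<Sum>i = 0..n. f (grid_point a b n i))
      = (\<Sum>i = 0..n. f (grid_point a b n i) + f (grid_point a b n (n - i)))"
    using sum.atLeastAtMost_rev[of "\<lambda>i. f (grid_point a b n i)" 0 n] by (simp add: sum.distrib)
  also have "\<dots> \<le> (\<Sum>i = 0..n. f a + f b)"
  proof (rule sum_mono)
    fix i assume i: "i \<in> {0..n}"
    have "grid_point a b n (n - i) = a + b - grid_point a b n i"
      using i n by (simp add: grid_point_def of_nat_diff field_simps)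
    with convex_on_Icc_reflect_le[OF f grid_point_in_Icc, of n i] i n \<open>a \<le> b\<close>
    show "f (grid_point a b n i) + f (grid_point a b n (n - i)) \<le> f a + f b" by simp
  qed
  finally show ?thesis by (simp add: algebra_simps)
qed

text \<open>With node sum \<open>S\<close> and endpoint mean \<open>E\<close>, the trapezoid sum is
  \<open>S - E\<close>; clearing denominators leaves \<open>S \<le> (n + 1) * E\<close>.\<close>

lemma trapezoid_sum_le_grid_mean:
  fixes f :: "real \<Rightarrow> real"
  assumes f: "convex_on {a..b} f" and "a \<le> b" and n: "n \<ge> 1"
  shows "1 / real n * (\<Sum>i<n. (f (grid_point a b n i) + f (grid_point a b n (Suc i))) / 2)
    \<le> 1 / (real n + 1) * (\<Sum>i = 0..n. f (grid_point a b n i))"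
proof -
  define S where "S = (\<Sum>i = 0..n. f (grid_point a b n i))"
  define E where "E = (f a + f b) / 2"
  have T: "(\<Sum>i<n. (f (grid_point a b n i) + f (grid_point a b n (Suc i))) / 2) = S - E"
    using sum_adjacent[of "\<lambda>i. f (grid_point a b n i)" n] n
    unfolding S_def E_def sum_divide_distrib[symmetric] by (simp add: field_simps)
  have "S \<le> (real n + 1) * E"
    unfolding S_def E_def by (rule grid_sum_le_endpoints[OF assms])
  then have "1 / real n * (S - E) \<le> 1 / (real n + 1) * S"
    using n by (simp add: field_simps)
  then show ?thesis unfolding T S_def .
qed

section \<open>From the cells to the whole interval\<close>

theorem corollary2p4:
  fixes a b :: real and f :: "real \<Rightarrow> real"
  assumes "a < b"
    and "convex_on {a..b} f"
  shows "(\<forall>m n :: nat. m \<ge> 2 \<longrightarrow> n \<ge> 1 \<longrightarrow>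
            1 / (real m - 1) * (\<Sum>i = 1..m - 1. f (grid_point a b m i))
              \<le> 1 / (b - a) * integral {a..b} f
          \<and> 1 / (b - a) * integral {a..b} f
              \<le> 1 / (real n + 1) * (\<Sum>i = 0..n. f (grid_point a b n i)))
       \<and> (strictly_convex_on {a..b} f \<longrightarrow>
          (\<forall>m n :: nat. m \<ge> 2 \<longrightarrow> n \<ge> 1 \<longrightarrow>
            1 / (real m - 1) * (\<Sum>i = 1..m - 1. f (grid_point a b m i))
              < 1 / (b - a) * integral {a..b} f
          \<and> 1 / (b - a) * integral {a..b} f
              < 1 / (real n + 1) * (\<Sum>i = 0..n. f (grid_point a b n i))))"
proof -
  define M where "M k = (\<Sum>i<k. f ((grid_point a b k i + grid_point a b k (Suc i)) / 2))" for k
  define T where "T k = (\<Sum>i<k. (f (grid_point a b k i) + f (grid_point a b k (Suc i))) / 2)" for k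
  have int: "f integrable_on {a..b}" by (rule convex_on_Icc_integrable[OF assms(2)])
  \<comment> \<open>The factor \<open>k / (b - a)\<close> is the reciprocal cell length: the mean of
    \<open>f\<close> is the average of its \<open>k\<close> cell means, to be compared termwise with
    \<open>M k\<close> and \<open>T k\<close>.\<close>
  have mean: "1 / (b - a) * integral {a..b} f = 1 / real k *
      (\<Sum>i<k. real k / (b - a) * integral {grid_point a b k i..grid_point a b k (Suc i)} f)"
    if "k > 0" for k
    using integral_eq_sum_grid[OF int, of k] that \<open>a < b\<close>
    unfolding sum_distrib_left[symmetric] by simp
  have cell: "grid_point a b k i < grid_point a b k (Suc i)" if "k > 0" for k i
    using grid_point_Suc_diff[of a b k i] that \<open>a < b\<close>
    by (smt (verit) divide_pos_pos of_nat_0_less_iff)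
  have scale: "real k / (b - a) * ((grid_point a b k (Suc i) - grid_point a b k i) * z) = z"
    if "k > 0" for k i z
    using that \<open>a < b\<close> by (simp add: grid_point_Suc_diff)
  have lower: "1 / (real m - 1) * (\<Sum>i = 1..m - 1. f (grid_point a b m i))
      \<le> 1 / real (m - 1) * M (m - 1)" if "m \<ge> 2" for m
    using interior_grid_sum_le_midpoint_sum[OF assms(2) _ that] that \<open>a < b\<close>
    by (simp add: M_def of_nat_diff divide_right_mono)
  have upper: "1 / real n * T n \<le> 1 / (real n + 1) * (\<Sum>i = 0..n. f (grid_point a b n i))"
    if "n \<ge> 1" for n
    unfolding T_def using trapezoid_sum_le_grid_mean[OF assms(2) _ that] \<open>a < b\<close> by simp
  have weak: "1 / real k * M k \<le> 1 / (b - a) * integral {a..b} f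
      \<and> 1 / (b - a) * integral {a..b} f \<le> 1 / real k * T k" if k: "k > 0" for k
  proof -
    have pos: "0 \<le> real k / (b - a)" using \<open>a < b\<close> by simp
    have c: "convex_on {grid_point a b k i..grid_point a b k (Suc i)} f" if "i < k" for i
      using grid_cell_subset[of a b i k] that \<open>a < b\<close> by (auto intro: convex_on_subset[OF assms(2)])
    \<comment> \<open>Dividing by the cell length turns the integral bounds into bounds on the cell
      mean.\<close>
    note hh = hermite_hadamard[OF c less_imp_le[OF cell[OF k]], THEN mult_left_mono[OF _ pos],
        unfolded scale[OF k]]
    show ?thesis
      unfolding mean[OF k] M_def T_def using k
      by (intro conjI mult_left_mono sum_mono hh) auto
  qed
  \<comment> \<open>Strictness comes from the cells alone, while \<open>lower\<close> and
    \<open>upper\<close> stay weak. Strict summation needs at least one cell, hence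
    \<open>ne\<close>.\<close>
  have strict: "1 / real k * M k < 1 / (b - a) * integral {a..b} f
      \<and> 1 / (b - a) * integral {a..b} f < 1 / real k * T k"
    if k: "k > 0" and f: "strictly_convex_on {a..b} f" for k
  proof -
    have pos: "0 < real k / (b - a)" using k \<open>a < b\<close> by simp
    have c: "strictly_convex_on {grid_point a b k i..grid_point a b k (Suc i)} f" if "i < k" for i
      using grid_cell_subset[of a b i k] that \<open>a < b\<close> by (auto intro: strictly_convex_on_subset[OF f])
    note hh = hermite_hadamard_strict[OF c cell[OF k], THEN mult_strict_left_mono[OF _ pos],
        unfolded scale[OF k]]
    have ne: "{..<k} \<noteq> {}" using k by auto
    show ?thesis
      unfolding mean[OF k] M_def T_def using k ne
      by (intro conjI mult_strict_left_mono sum_strict_mono hh) auto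
  qed
  show ?thesis
  proof (intro conjI impI allI)
    fix m n :: nat assume m: "m \<ge> 2" and n: "n \<ge> 1"
    then have k: "m - 1 > 0" "n > 0" by auto
    show "1 / (real m - 1) * (\<Sum>i = 1..m - 1. f (grid_point a b m i))
        \<le> 1 / (b - a) * integral {a..b} f"
      by (rule order_trans[OF lower[OF m] conjunct1[OF weak[OF k(1)]]])
    show "1 / (b - a) * integral {a..b} f
        \<le> 1 / (real n + 1) * (\<Sum>i = 0..n. f (grid_point a b n i))"
      by (rule order_trans[OF conjunct2[OF weak[OF k(2)]] upper[OF n]])
    assume f: "strictly_convex_on {a..b} f"
    show "1 / (real m - 1) * (\<Sum>i = 1..m - 1. f (grid_point a b m i))
        < 1 / (b - a) * integral {a..b} f"
      by (rule le_less_trans[OF lower[OF m] conjunct1[OF strict[OF k(1) f]]])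
    show "1 / (b - a) * integral {a..b} f
        < 1 / (real n + 1) * (\<Sum>i = 0..n. f (grid_point a b n i))"
      by (rule less_le_trans[OF conjunct2[OF strict[OF k(2) f]] upper[OF n]])
  qed
qed

end
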